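(* Let $a,b,c\in\mathbb{R}$ and let $A$ be either a split generalized quaternion algebra $\mathbb{H}(a,b)$ or a split generalized octonion algebra $\mathbb{O}(a,b,c)$ over $K=\mathbb{R}$. If an element $x\in A$ is $k$-potent (for an integer $k>1$) with norm $\mathbf{n}(x)=0$ and trace $\mathbf{t}(x)\neq 0$, then $\mathbf{t}(x)^k=\mathbf{t}(x)$, therefore $\mathbf{t}(x)=1$ or $\mathbf{t}(x)=-1$, and the coefficient $x_0$ of $1$ in $x$ is $x_0=\mathbf{t}(x)/2$. Moreover $\mathbf{t}(x)^2=\mathbf{t}(x)$ or $\mathbf{t}(x)^3=\mathbf{t}(x)$; therefore the only $k$-potent elements ($k>1$) in $A$ over $\mathbb{R}$ are idempotent and tripotent elements.
   Context: An element $x$ of a (power-associative) ring is called $k$-potent, for an integer $k>1$, if $k$ is the smallest integer greater than $1$ such that $x^k=x$; idempotent means $2$-potent and tripotent means $3$-potent. $\mathbb{H}(a,b)$ is the 4-dimensional associative algebra over $\mathbb{R}$ with basis $\{1,f_1,f_2,f_3\}$, unit $1$, and $f_1^2=a$, $f_2^2=b$, $f_3^2=-ab$, $f_1f_2=f_3=-f_2f_1$, $f_1f_3=af_2=-f_3f_1$, $f_2f_3=-bf_1=-f_3f_2$. $\mathbb{O}(a,b,c)$ is the 8-dimensional algebra over $\mathbb{R}$ with basis $\{1,f_1,\dots,f_7\}$, unit $1$, and products $f_if_j$ given by the following rows (row $f_i$ lists $f_if_1,f_if_2,\dots,f_if_7$): $f_1$: $a,\ f_3,\ af_2,\ f_5,\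 af_4,\ -f_7,\ -af_6$; $f_2$: $-f_3,\ b,\ -bf_1,\ f_6,\ f_7,\ bf_4,\ bf_5$; $f_3$: $-af_2,\ bf_1,\ -ab,\ f_7,\ af_6,\ -bf_5,\ -abf_4$; $f_4$: $-f_5,\ -f_6,\ -f_7,\ c,\ -cf_1,\ -cf_2,\ -cf_3$; $f_5$: $-af_4,\ -f_7,\ -af_6,\ cf_1,\ -ac,\ cf_3,\ acf_2$; $f_6$: $f_7,\ -bf_4,\ bf_5,\ cf_2,\ -cf_3,\ -bc,\ -bcf_1$; $f_7$: $af_6,\ -bf_5,\ abf_4,\ cf_3,\ -acf_2,\ bcf_1,\ abc$. It is non-associative but alternative and power-associative, so powers are well defined. In either algebra, for $x=x_0+\sum_i x_if_i$ the conjugate is $\overline{x}=x_0-\sum_i x_if_i$, the trace is $\mathbf{t}(x)=x+\overline{x}\in\mathbb{R}$, and the norm is $\mathbf{n}(x)=x\overline{x}\in\mathbb{R}$. The algebra is a division algebra if $\mathbf{n}(x)=0$ implies $x=0$, and it is called split if it is not a division algebra.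
   Formalization: The last claim, that the only k-potent elements are idempotent and tripotent, is stated only for x with n(x)=0 and t(x)≠0; without these it is false: in the split algebra H(-1,1), f_1 has norm 1 and is 5-potent. *)

theory Defs
  imports "HOL-Analysis.Analysis"
begin

text \<open>
  An algebra over the reals with basis \<open>1 = f\<^sub>0, f\<^sub>1, \<dots>, f\<^sub>n\<^sub>-\<^sub>1\<close> is given by the table \<open>T\<close> of the products
  of its basis elements, \<open>T ! i ! j = f\<^sub>i f\<^sub>j\<close>. Its elements are coordinate vectors. Coordinates are
  counted from \<open>0\<close>: in the index types \<open>4\<close> and \<open>8\<close> the elements are \<open>0, \<dots>, 3\<close> and \<open>0, \<dots>, 7\<close>.
  The class operations \<open>*\<close>, \<open>1\<close>, \<open>^\<close> and \<open>norm\<close> on these vector types are unrelated to the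
  operations of the algebra and are not used.
\<close>

definition basis_el :: "nat \<Rightarrow> real ^ 'n::{finite, comm_ring_1}" where
  "basis_el i = axis (of_nat i) 1"

definition alg_mult ::
    "(real ^ 'n::{finite, comm_ring_1}) list list \<Rightarrow> real ^ 'n::{finite, comm_ring_1} \<Rightarrow> real ^ 'n::{finite, comm_ring_1} \<Rightarrow> real ^ 'n::{finite, comm_ring_1}" where
  "alg_mult T x y =
     (\<Sum>i<CARD('n). \<Sum>j<CARD('n). (x $ of_nat i * y $ of_nat j) *\<^sub>R (T ! i ! j))"

text \<open>The algebras considered below are power-associative, so the bracketing chosen here does not matter.\<close>

primrec alg_power ::
    "(real ^ 'n::{finite, comm_ring_1}) list list \<Rightarrow> real ^ 'n::{finite, comm_ring_1} \<Rightarrow> nat \<Rightarrow> real ^ 'n::{finite, comm_ring_1}" where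
  "alg_power T x 0 = basis_el 0"
| "alg_power T x (Suc m) = alg_mult T x (alg_power T x m)"

definition k_potent ::
    "(real ^ 'n::{finite, comm_ring_1}) list list \<Rightarrow> nat \<Rightarrow> real ^ 'n::{finite, comm_ring_1} \<Rightarrow> bool" where
  "k_potent T k x \<longleftrightarrow>
     k > 1 \<and> alg_power T x k = x \<and> (\<forall>m. m > 1 \<and> alg_power T x m = x \<longrightarrow> k \<le> m)"

abbreviation idempotent ::
    "(real ^ 'n::{finite, comm_ring_1}) list list \<Rightarrow> real ^ 'n::{finite, comm_ring_1} \<Rightarrow> bool" where
  "idempotent T \<equiv> k_potent T 2"

abbreviation tripotent ::
    "(real ^ 'n::{finite, comm_ring_1}) list list \<Rightarrow> real ^ 'n::{finite, comm_ring_1} \<Rightarrow> bool" where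
  "tripotent T \<equiv> k_potent T 3"

definition alg_conj :: "real ^ 'n::{finite, comm_ring_1} \<Rightarrow> real ^ 'n::{finite, comm_ring_1}" where
  "alg_conj x = (\<chi> i. if i = 0 then x $ i else - (x $ i))"

text \<open>
  Trace and norm are scalar multiples of the unit (lemmas \<open>alg_trace_scalar\<close>, \<open>quat_norm_scalar\<close>,
  \<open>oct_norm_scalar\<close> below), so the coefficient of the unit is the real number they are identified with.
\<close>

definition alg_trace :: "real ^ 'n::{finite, comm_ring_1} \<Rightarrow> real" where
  "alg_trace x = (x + alg_conj x) $ 0"

definition alg_norm ::
    "(real ^ 'n::{finite, comm_ring_1}) list list \<Rightarrow> real ^ 'n::{finite, comm_ring_1} \<Rightarrow> real" where
  "alg_norm T x = alg_mult T x (alg_conj x) $ 0"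

definition division_alg :: "(real ^ 'n::{finite, comm_ring_1}) list list \<Rightarrow> bool" where
  "division_alg T \<longleftrightarrow> (\<forall>x. alg_norm T x = 0 \<longrightarrow> x = 0)"

definition split_alg :: "(real ^ 'n::{finite, comm_ring_1}) list list \<Rightarrow> bool" where
  "split_alg T \<longleftrightarrow> \<not> division_alg T"

definition quat_alg :: "real \<Rightarrow> real \<Rightarrow> (real ^ 4) list list" where
  "quat_alg a b =
    (let e = basis_el 0; f1 = basis_el 1; f2 = basis_el 2; f3 = basis_el 3 in
     [[e,  f1,               f2,               f3],
      [f1, a *\<^sub>R e,           f3,               a *\<^sub>R f2],
      [f2, - f3,             b *\<^sub>R e,           (-b) *\<^sub>R f1],
      [f3, (-a) *\<^sub>R f2,       b *\<^sub>R f1,          (-(a*b)) *\<^sub>R e]])"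

definition oct_alg :: "real \<Rightarrow> real \<Rightarrow> real \<Rightarrow> (real ^ 8) list list" where
  "oct_alg a b c =
    (let e = basis_el 0; f1 = basis_el 1; f2 = basis_el 2; f3 = basis_el 3;
         f4 = basis_el 4; f5 = basis_el 5; f6 = basis_el 6; f7 = basis_el 7 in
     [[e,  f1, f2, f3, f4, f5, f6, f7],
      [f1, a *\<^sub>R e, f3, a *\<^sub>R f2, f5, a *\<^sub>R f4, - f7, (-a) *\<^sub>R f6],
      [f2, - f3, b *\<^sub>R e, (-b) *\<^sub>R f1, f6, f7, b *\<^sub>R f4, b *\<^sub>R f5],
      [f3, (-a) *\<^sub>R f2, b *\<^sub>R f1, (-(a*b)) *\<^sub>R e, f7, a *\<^sub>R f6, (-b) *\<^sub>R f5, (-(a*b)) *\<^sub>R f4],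
      [f4, - f5, - f6, - f7, c *\<^sub>R e, (-c) *\<^sub>R f1, (-c) *\<^sub>R f2, (-c) *\<^sub>R f3],
      [f5, (-a) *\<^sub>R f4, - f7, (-a) *\<^sub>R f6, c *\<^sub>R f1, (-(a*c)) *\<^sub>R e, c *\<^sub>R f3, (a*c) *\<^sub>R f2],
      [f6, f7, (-b) *\<^sub>R f4, b *\<^sub>R f5, c *\<^sub>R f2, (-c) *\<^sub>R f3, (-(b*c)) *\<^sub>R e, (-(b*c)) *\<^sub>R f1],
      [f7, a *\<^sub>R f6, (-b) *\<^sub>R f5, (a*b) *\<^sub>R f4, c *\<^sub>R f3, (-(a*c)) *\<^sub>R f2, (b*c) *\<^sub>R f1, (a*b*c) *\<^sub>R e]])"

lemma alg_trace_scalar: "x + alg_conj x = alg_trace x *\<^sub>R basis_el 0"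
  by (simp add: vec_eq_iff alg_trace_def alg_conj_def basis_el_def axis_def)

lemma vec4_eq_iff:
  "x = y \<longleftrightarrow> x $ 0 = y $ 0 \<and> x $ 1 = y $ 1 \<and> x $ 2 = y $ 2 \<and> x $ 3 = y $ 3" for x y :: "'a ^ 4"
proof -
  have "(4::4) = 0" by simp
  then show ?thesis unfolding vec_eq_iff forall_4 by metis
qed

lemma exhaust_8_from_0: "i = 0 \<or> i = 1 \<or> i = 2 \<or> i = 3 \<or> i = 4 \<or> i = 5 \<or> i = 6 \<or> i = 7" for i :: 8
proof (induct i)
  case (of_int z)
  then have "z = 0 \<or> z = 1 \<or> z = 2 \<or> z = 3 \<or> z = 4 \<or> z = 5 \<or> z = 6 \<or> z = 7"
    by simp arith
  then show ?case by (elim disjE) simp_all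
qed

lemma vec8_eq_iff:
  "x = y \<longleftrightarrow> x $ 0 = y $ 0 \<and> x $ 1 = y $ 1 \<and> x $ 2 = y $ 2 \<and> x $ 3 = y $ 3 \<and>
             x $ 4 = y $ 4 \<and> x $ 5 = y $ 5 \<and> x $ 6 = y $ 6 \<and> x $ 7 = y $ 7" for x y :: "'a ^ 8"
proof
  assume "x $ 0 = y $ 0 \<and> x $ 1 = y $ 1 \<and> x $ 2 = y $ 2 \<and> x $ 3 = y $ 3 \<and>
          x $ 4 = y $ 4 \<and> x $ 5 = y $ 5 \<and> x $ 6 = y $ 6 \<and> x $ 7 = y $ 7"
  then have "x $ i = y $ i" for i
    using exhaust_8_from_0[of i] by (elim disjE) simp_all
  then show "x = y" by (simp add: vec_eq_iff)
qed simp

lemma sum_less_4: "sum g {..<4} = g 0 + g 1 + g 2 + g 3" for g :: "nat \<Rightarrow> 'a::comm_monoid_add"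
  by (simp add: lessThan_nat_numeral lessThan_Suc add_ac)

lemma sum_less_8: "sum g {..<8} = g 0 + g 1 + g 2 + g 3 + g 4 + g 5 + g 6 + g 7"
  for g :: "nat \<Rightarrow> 'a::comm_monoid_add"
  by (simp add: lessThan_nat_numeral lessThan_Suc add_ac)

lemma basis_el_4_nth:
  "(basis_el 0 :: real ^ 4) $ i = (if i = 0 then 1 else 0)"
  "(basis_el 1 :: real ^ 4) $ i = (if i = 1 then 1 else 0)"
  "(basis_el (numeral n) :: real ^ 4) $ i = (if i = numeral n then 1 else 0)"
  by (simp_all add: basis_el_def axis_def)

lemma basis_el_8_nth:
  "(basis_el 0 :: real ^ 8) $ i = (if i = 0 then 1 else 0)"
  "(basis_el 1 :: real ^ 8) $ i = (if i = 1 then 1 else 0)"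
  "(basis_el (numeral n) :: real ^ 8) $ i = (if i = numeral n then 1 else 0)"
  by (simp_all add: basis_el_def axis_def)

lemma quat_norm_scalar:
  "alg_mult (quat_alg a b) x (alg_conj x) = alg_norm (quat_alg a b) x *\<^sub>R basis_el 0"
  unfolding vec4_eq_iff alg_norm_def alg_mult_def quat_alg_def alg_conj_def Let_def
  by (simp add: sum_less_4 basis_el_4_nth algebra_simps)

lemma oct_norm_scalar:
  "alg_mult (oct_alg a b c) x (alg_conj x) = alg_norm (oct_alg a b c) x *\<^sub>R basis_el 0"
  unfolding vec8_eq_iff alg_norm_def alg_mult_def oct_alg_def alg_conj_def Let_def
  by (simp add: sum_less_8 basis_el_8_nth algebra_simps)

end

(* For a quadratic algebra x (t e - x) = n(x) e, so n(x) = 0 gives x x = t x and hence x^k = t^(k-1) x.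
   As t is nonzero, so is x, and k-potency reads t^(k-1) = 1; a real such t is 1 (x idempotent) or
   -1 (x tripotent). *)
theory Submission
  imports Defs
begin

lemma alg_mult_scaleR_right: "alg_mult T x (r *\<^sub>R y) = r *\<^sub>R alg_mult T x y"
  by (simp add: alg_mult_def scaleR_sum_right mult.left_commute)

lemma alg_mult_diff_right: "alg_mult T x (y - z) = alg_mult T x y - alg_mult T x z"
  by (simp add: alg_mult_def sum_subtractf algebra_simps)

lemma quat_mult_unit_right: "alg_mult (quat_alg a b) x (basis_el 0) = x"
  unfolding vec4_eq_iff alg_mult_def quat_alg_def Let_def
  by (simp add: sum_less_4 basis_el_4_nth del: One_nat_def)

lemma oct_mult_unit_right: "alg_mult (oct_alg a b c) x (basis_el 0) = x"
  unfolding vec8_eq_iff alg_mult_def oct_alg_def Let_def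
  by (simp add: sum_less_8 basis_el_8_nth del: One_nat_def)

lemma alg_trace_eq: "alg_trace x = 2 * x $ 0"
  by (simp add: alg_trace_def alg_conj_def)

text \<open>Substituting \<open>t e - x\<close> for the conjugate turns the second assumption into
  \<open>t x - x x = 0\<close>. This takes only linearity in the right factor and the right unit, no
  associativity, so octonions are covered. The vanishing norm is given as a vector equation because
  for an arbitrary table \<open>alg_norm\<close> records only the coefficient of the unit.\<close>

lemma alg_mult_self_norm_zero:
  assumes unit: "alg_mult T x (basis_el 0) = x" and conj: "alg_mult T x (alg_conj x) = 0"
  shows "alg_mult T x x = alg_trace x *\<^sub>R x"
proof -
  have "alg_conj x = alg_trace x *\<^sub>R basis_el 0 - x"
    using alg_trace_scalar[of x] by (simp add: eq_diff_eq add.commute)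
  then show ?thesis
    using unit conj by (simp add: alg_mult_diff_right alg_mult_scaleR_right)
qed

text \<open>\<open>alg_power\<close> multiplies by \<open>x\<close> on the left, so each step pulls
  the scalar \<open>t ^ m\<close> out of the right factor and is left with \<open>x x = t x\<close>;
  again nothing is reassociated.\<close>

lemma alg_power_Suc_of_square_eq:
  assumes "alg_mult T x (basis_el 0) = x" and "alg_mult T x x = t *\<^sub>R x"
  shows "alg_power T x (Suc m) = t ^ m *\<^sub>R x"
proof (induction m)
  case (Suc m)
  then show ?case
    using assms(2) by (simp only: alg_power.simps(2)[of T x "Suc m"] alg_mult_scaleR_right) simp
qed (use assms in simp)

text \<open>The arbitrary table \<open>T\<close> lets one argument serve both families of
  algebras.\<close>

lemma k_potent_norm_zero:
  assumes unit: "alg_mult T x (basis_el 0) = x" and conj: "alg_mult T x (alg_conj x) = 0"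
    and pot: "k_potent T k x" and trace: "alg_trace x \<noteq> 0"
  shows "alg_trace x ^ k = alg_trace x \<and>
    (alg_trace x = 1 \<or> alg_trace x = - 1) \<and>
    x $ 0 = alg_trace x / 2 \<and>
    (alg_trace x ^ 2 = alg_trace x \<or> alg_trace x ^ 3 = alg_trace x) \<and>
    (idempotent T x \<or> tripotent T x)"
proof -
  define t where "t = alg_trace x"
  have x: "x \<noteq> 0"
    using trace by (auto simp: alg_trace_eq)
  have pow: "alg_power T x (Suc m) = t ^ m *\<^sub>R x" for m
    unfolding t_def
    by (rule alg_power_Suc_of_square_eq[OF unit alg_mult_self_norm_zero[OF unit conj]])
  \<comment> \<open>Cancelling the nonzero vector \<open>x\<close> from \<open>t ^ m x = 1 x\<close>
    reduces potency to a condition on the real number \<open>t\<close>, with exponent one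
    lower.\<close>
  have pow_eq: "alg_power T x (Suc m) = x \<longleftrightarrow> t ^ m = 1" for m
    using x by (auto simp only: pow scaleR_cancel_right[of _ x 1, simplified])
  obtain l where k: "k = Suc l" "l > 0"
    using pot by (cases k) (auto simp: k_potent_def)
  have tl: "t ^ l = 1"
    using pot pow_eq by (simp only: k_potent_def k)
  \<comment> \<open>A real root of unity has absolute value 1; \<open>l > 0\<close>, which comes
    from \<open>k > 1\<close>, excludes the trivial zeroth power.\<close>
  then have "\<bar>t\<bar> = 1"
    using power_eq_1_iff[of t l] k(2) by simp
  then have t: "t = 1 \<or> t = - 1"
    by linarith
  have two: "alg_power T x 2 = x \<longleftrightarrow> t = 1" and three: "alg_power T x 3 = x \<longleftrightarrow> t ^ 2 = 1"
    using pow_eq[of 1] pow_eq[of 2] by (simp_all add: numeral_2_eq_2 numeral_3_eq_3)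
  have "idempotent T x \<or> tripotent T x"
  proof (cases "t = 1")
    case True
    then show ?thesis using two by (simp add: k_potent_def)
  next
    case False
    \<comment> \<open>Now \<open>t = - 1\<close> and \<open>x x = - x\<close>, which differs from
      \<open>x\<close>; so exponent 2 fails and 3 is the smallest one left.\<close>
    have "3 \<le> m" if "m > 1" "alg_power T x m = x" for m
      using that False two by (cases "m = 2") auto
    then show ?thesis using three t False by (auto simp: k_potent_def)
  qed
  moreover have "x $ 0 = t / 2"
    by (simp add: t_def alg_trace_eq)
  moreover have "t ^ k = t"
    using tl k by simp
  ultimately show ?thesis
    using t unfolding t_def by auto
qed

theorem mainTheorem3:
  fixes a b c :: real
  shows "(split_alg (quat_alg a b) \<longrightarrow>
           (\<forall>(x :: real ^ 4) (k :: nat).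
              k_potent (quat_alg a b) k x \<and> alg_norm (quat_alg a b) x = 0 \<and> alg_trace x \<noteq> 0 \<longrightarrow>
                alg_trace x ^ k = alg_trace x \<and>
                (alg_trace x = 1 \<or> alg_trace x = - 1) \<and>
                x $ 0 = alg_trace x / 2 \<and>
                (alg_trace x ^ 2 = alg_trace x \<or> alg_trace x ^ 3 = alg_trace x) \<and>
                (idempotent (quat_alg a b) x \<or> tripotent (quat_alg a b) x)))
       \<and> (split_alg (oct_alg a b c) \<longrightarrow>
           (\<forall>(x :: real ^ 8) (k :: nat).
              k_potent (oct_alg a b c) k x \<and> alg_norm (oct_alg a b c) x = 0 \<and> alg_trace x \<noteq> 0 \<longrightarrow>
                alg_trace x ^ k = alg_trace x \<and>
                (alg_trace x = 1 \<or> alg_trace x = - 1) \<and>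
                x $ 0 = alg_trace x / 2 \<and>
                (alg_trace x ^ 2 = alg_trace x \<or> alg_trace x ^ 3 = alg_trace x) \<and>
                (idempotent (oct_alg a b c) x \<or> tripotent (oct_alg a b c) x)))"
  \<comment> \<open>The product of \<open>x\<close> with its conjugate is a multiple of the unit in
    both algebras, so a zero \<open>alg_norm\<close> makes the whole product vanish, as the general
    lemma requires.\<close>
  by (rule conjI; intro impI allI; elim conjE; rule k_potent_norm_zero)
    (simp_all add: quat_mult_unit_right oct_mult_unit_right quat_norm_scalar oct_norm_scalar)

end
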